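(* Let $G$ be a locally compact group and let $(\pi,\mathcal{H})$ be a unitary, square-integrable representation of $G$ on a Hilbert space $\mathcal{H}$. Let $g,h\in\mathcal{H}$ with $g\ne 0$ nice, and let $(x_j)_{j\in J}$ and $(y_k)_{k\in I}$ be families of points of $G$ such that $\mathcal{E}_g=\{\pi(x_j)g : j\in J\}$ and $\mathcal{E}_h=\{\pi(y_k)h : k\in I\}$ are frames for $\mathcal{H}$. Let $B>0$ be an upper frame bound of $\mathcal{E}_h$. Then, given $\epsilon>0$, there exists a compact set $L\subseteq G$ such that for all $y\in G$ and all compact sets $K\subseteq G$ $$\|h\|^2\,B^{-1}(1-\epsilon)\,\mathrm{card}\{k\in I : y_k\in yK\}\le \mathrm{card}\{j\in J : x_j\in yKL\}.$$
   Context: $G$ carries left Haar measure $dx$. Fix a symmetric compact neighborhood $U=U^{-1}\subseteq G$ of the identity $e$. For a function $F$ on $G$ the local maximum function is $F^\sharp(x)=\sup_{y\in xU}|F(y)|$, and the left amalgam space $W(L^\infty,L^2)$ is defined by the norm $\|F\|_{W(L^\infty,L^2)}=\|F^\sharp\|_{L^2(G)}$, i.e. it consists of the $F$ for which this norm is finite. For $g\in\mathcal{H}$ and $f\in\mathcal{H}$, set $V_gf(x)=\langle f,\pi(x)g\rangle$, $x\in G$. Unitary representations are strongly continuous. Square-integrable means that there is a nonzero $g_0\in\mathcal{H}$ with $V_{g_0}f\in L^2(G)$ for all $f\in\mathcal{H}$. A vector $g\in\mathcal{H}$ is called nice if $V_gf\in W(L^\infty,L^2)$ for every $f\in\mathcal{H}$.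 A family $\{e_k\}$ in $\mathcal{H}$ is a frame for $\mathcal{H}$ with (lower and upper) frame bounds $A,B>0$ if $A\|f\|^2\le\sum_k|\langle f,e_k\rangle|^2\le B\|f\|^2$ for all $f\in\mathcal{H}$. For sets $K,L\subseteq G$ and $y\in G$, $yKL=\{ykl : k\in K,\ l\in L\}$. *)

theory Defs
  imports "HOL-Analysis.Analysis"
begin

section \<open>Complex Hilbert spaces\<close>

class complex_inner = real_normed_vector +
  fixes scaleC :: "complex \<Rightarrow> 'a \<Rightarrow> 'a" (infixr "*\<^sub>C" 75)
    and cinner :: "'a \<Rightarrow> 'a \<Rightarrow> complex"
  assumes scaleC_add_right: "a *\<^sub>C (x + y) = a *\<^sub>C x + a *\<^sub>C y"
    and scaleC_add_left: "(a + b) *\<^sub>C x = a *\<^sub>C x + b *\<^sub>C x"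
    and scaleC_scaleC: "a *\<^sub>C b *\<^sub>C x = (a * b) *\<^sub>C x"
    and scaleC_of_real: "complex_of_real r *\<^sub>C x = r *\<^sub>R x"
    and cinner_commute: "cinner x y = cnj (cinner y x)"
    and cinner_add_left: "cinner (x + y) z = cinner x z + cinner y z"
    and cinner_scaleC_left: "cinner (a *\<^sub>C x) y = a * cinner x y"
    and cinner_self: "cinner x x = complex_of_real ((norm x)\<^sup>2)"

class complex_hilbert = complex_inner + complete_space

section \<open>Left Haar measures\<close>

text \<open>
  Groups are written additively, because the topological groups of the library
  (class \<^class>\<open>topological_group_add\<close>) are; they need not be commutative.
  So \<open>x + y\<close> is the product \<open>xy\<close>, \<open>- x\<close> is the inverse of \<open>x\<close>, and
  \<open>0\<close> is the identity \<open>e\<close>. Left translation by \<open>x\<close> is \<open>(+) x\<close>.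
\<close>

definition left_haar_measure :: "'g::{topological_group_add, t2_space} measure \<Rightarrow> bool" where
  "left_haar_measure M \<longleftrightarrow>
     sets M = sets borel \<and>
     emeasure M UNIV \<noteq> 0 \<and>
     (\<forall>K. compact K \<longrightarrow> emeasure M K < \<infinity>) \<and>
     (\<forall>A\<in>sets borel. emeasure M A = (INF V\<in>{V. open V \<and> A \<subseteq> V}. emeasure M V)) \<and>
     (\<forall>V. open V \<longrightarrow> emeasure M V = (SUP K\<in>{K. compact K \<and> K \<subseteq> V}. emeasure M K)) \<and>
     (\<forall>x. \<forall>A\<in>sets borel. emeasure M ((+) x ` A) = emeasure M A)"

section \<open>Function spaces\<close>

text \<open>
  Magnitudes of functions are taken in \<^typ>\<open>ennreal\<close>, since a local maximum function
  may take the value \<open>\<infinity>\<close>.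
\<close>

definition L2_norm :: "'g measure \<Rightarrow> ('g \<Rightarrow> ennreal) \<Rightarrow> ennreal" where
  "L2_norm M F =
     (let I = (\<integral>\<^sup>+ x. (F x)\<^sup>2 \<partial>M) in if I = \<infinity> then \<infinity> else ennreal (sqrt (enn2real I)))"

definition in_L2 :: "'g measure \<Rightarrow> ('g \<Rightarrow> complex) \<Rightarrow> bool" where
  "in_L2 M F \<longleftrightarrow> F \<in> borel_measurable M \<and> L2_norm M (\<lambda>x. ennreal (cmod (F x))) < \<infinity>"

definition local_max :: "'g::plus set \<Rightarrow> ('g \<Rightarrow> complex) \<Rightarrow> 'g \<Rightarrow> ennreal" where
  "local_max U F x = (SUP y\<in>(+) x ` U. ennreal (cmod (F y)))"

definition amalgam_norm :: "'g::plus measure \<Rightarrow> 'g set \<Rightarrow> ('g \<Rightarrow> complex) \<Rightarrow> ennreal" where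
  "amalgam_norm M U F = L2_norm M (local_max U F)"

definition in_amalgam :: "'g::plus measure \<Rightarrow> 'g set \<Rightarrow> ('g \<Rightarrow> complex) \<Rightarrow> bool" where
  "in_amalgam M U F \<longleftrightarrow> local_max U F \<in> borel_measurable M \<and> amalgam_norm M U F < \<infinity>"

section \<open>Unitary representations\<close>

definition unitary_operator :: "('h::complex_inner \<Rightarrow> 'h) \<Rightarrow> bool" where
  "unitary_operator T \<longleftrightarrow>
     (\<forall>u v. T (u + v) = T u + T v) \<and>
     (\<forall>a u. T (a *\<^sub>C u) = a *\<^sub>C T u) \<and>
     (\<forall>u v. cinner (T u) (T v) = cinner u v) \<and>
     surj T"

definition unitary_rep ::
  "('g::topological_group_add \<Rightarrow> 'h::complex_hilbert \<Rightarrow> 'h) \<Rightarrow> bool" where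
  "unitary_rep \<pi> \<longleftrightarrow>
     (\<forall>x. unitary_operator (\<pi> x)) \<and>
     (\<forall>x y. \<pi> (x + y) = \<pi> x \<circ> \<pi> y) \<and>
     (\<forall>f. continuous_on UNIV (\<lambda>x. \<pi> x f))"

definition matrix_coeff :: "('g \<Rightarrow> 'h::complex_inner \<Rightarrow> 'h) \<Rightarrow> 'h \<Rightarrow> 'h \<Rightarrow> 'g \<Rightarrow> complex" where
  "matrix_coeff \<pi> g f x = cinner f (\<pi> x g)"

definition square_integrable_rep ::
  "'g measure \<Rightarrow> ('g \<Rightarrow> 'h::complex_hilbert \<Rightarrow> 'h) \<Rightarrow> bool" where
  "square_integrable_rep M \<pi> \<longleftrightarrow> (\<exists>g0. g0 \<noteq> 0 \<and> (\<forall>f. in_L2 M (matrix_coeff \<pi> g0 f)))"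

definition nice_vector ::
  "'g::plus measure \<Rightarrow> 'g set \<Rightarrow> ('g \<Rightarrow> 'h::complex_hilbert \<Rightarrow> 'h) \<Rightarrow> 'h \<Rightarrow> bool" where
  "nice_vector M U \<pi> g \<longleftrightarrow> (\<forall>f. in_amalgam M U (matrix_coeff \<pi> g f))"

section \<open>Frames\<close>

definition frame_sum :: "'i set \<Rightarrow> ('i \<Rightarrow> 'h::complex_inner) \<Rightarrow> 'h \<Rightarrow> ennreal" where
  "frame_sum I e f = (\<Sum>\<^sub>\<infinity>k\<in>I. ennreal ((cmod (cinner f (e k)))\<^sup>2))"

definition lower_frame_bound :: "'i set \<Rightarrow> ('i \<Rightarrow> 'h::complex_inner) \<Rightarrow> real \<Rightarrow> bool" where
  "lower_frame_bound I e A \<longleftrightarrow> A > 0 \<and> (\<forall>f. ennreal (A * (norm f)\<^sup>2) \<le> frame_sum I e f)"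

definition upper_frame_bound :: "'i set \<Rightarrow> ('i \<Rightarrow> 'h::complex_inner) \<Rightarrow> real \<Rightarrow> bool" where
  "upper_frame_bound I e B \<longleftrightarrow> B > 0 \<and> (\<forall>f. frame_sum I e f \<le> ennreal (B * (norm f)\<^sup>2))"

definition is_frame :: "'i set \<Rightarrow> ('i \<Rightarrow> 'h::complex_hilbert) \<Rightarrow> bool" where
  "is_frame I e \<longleftrightarrow> (\<exists>A B. lower_frame_bound I e A \<and> upper_frame_bound I e B)"

section \<open>Counting\<close>

text \<open>
  \<^const>\<open>card\<close> is \<open>0\<close> on infinite sets, hence this version with value \<open>\<infinity>\<close> there.
\<close>

definition ecard :: "'i set \<Rightarrow> ereal" where
  "ecard S = (if finite S then ereal (real (card S)) else \<infinity>)"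

end

theory Submission
  imports Defs
begin

text \<open>
  Niceness of \<open>g\<close> makes the coefficients \<open>\<langle>\<pi>(z)h, \<pi>(x\<^sub>j)g\<rangle>\<close> with \<open>x\<^sub>j\<close> outside \<open>zL\<close> have small
  square sum, uniformly in \<open>z\<close>: the sum is compared with the integral of the squared local
  maximum function off a compact set, the \<open>x\<^sub>j\<close> having bounded local multiplicity by the upper
  frame bound. So all \<open>\<pi>(y\<^sub>k)h\<close> with \<open>y\<^sub>k \<in> zK\<close> are close to a space \<open>W\<close> spanned by the dual frame
  elements with index in \<open>F = {j. x\<^sub>j \<in> zKL}\<close>, and summing the squared norms of their projections
  to \<open>W\<close> gives nearly \<open>\<parallel>h\<parallel>\<^sup>2\<close> per index \<open>k\<close>, but at most \<open>B dim W \<le> B card F\<close> in total.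
\<close>

section \<open>Positive definite Hermitian forms\<close>

lemma scaleC_zero_left: "0 *\<^sub>C x = (0 :: 'h::complex_inner)"
  using scaleC_of_real[of 0 x] by simp

lemma scaleC_minus_one: "(-1) *\<^sub>C x = - (x :: 'h::complex_inner)"
  using scaleC_of_real[of "-1" x] by simp

lemma scaleC_one: "1 *\<^sub>C x = (x :: 'h::complex_inner)"
  using scaleC_of_real[of 1 x] by simp

lemma scaleC_zero_right: "a *\<^sub>C 0 = (0 :: 'h::complex_inner)"
  using scaleC_add_right[of a 0 "0 :: 'h"] by simp

lemma scaleC_diff_left: "(a - b) *\<^sub>C x = a *\<^sub>C x - b *\<^sub>C (x :: 'h::complex_inner)"
  using scaleC_add_left[of "a - b" b x] by (simp add: eq_diff_eq)

lemma scaleC_sum: "a *\<^sub>C (\<Sum>i\<in>A. f i) = (\<Sum>i\<in>A. a *\<^sub>C (f i :: 'h::complex_inner))"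
  by (induction A rule: infinite_finite_induct) (auto simp: scaleC_add_right scaleC_zero_right)

definition csubspace :: "'h::complex_inner set \<Rightarrow> bool" where
  "csubspace V \<longleftrightarrow>
     0 \<in> V \<and> (\<forall>u\<in>V. \<forall>v\<in>V. u + v \<in> V) \<and> (\<forall>a. \<forall>v\<in>V. a *\<^sub>C v \<in> V)"

lemma csubspace_scaleC: "csubspace V \<Longrightarrow> v \<in> V \<Longrightarrow> a *\<^sub>C v \<in> V"
  by (simp add: csubspace_def)

lemma csubspace_diff: "csubspace V \<Longrightarrow> u \<in> V \<Longrightarrow> v \<in> V \<Longrightarrow> u - v \<in> V"
  by (metis csubspace_def diff_conv_add_uminus scaleC_minus_one)

lemma csubspace_sum:
  assumes "csubspace V" "\<And>i. i \<in> A \<Longrightarrow> f i \<in> V"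
  shows "(\<Sum>i\<in>A. f i) \<in> V"
  using assms(2)
proof (induction A rule: infinite_finite_induct)
  case (insert a A)
  then show ?case using assms(1) by (simp add: csubspace_def)
qed (use assms(1) in \<open>auto simp: csubspace_def\<close>)

text \<open>Abstract because two geometries on one space are needed: that of \<open>cinner\<close>,
  which measures approximation errors, and that of the frame form, in which the dual elements are
  Riesz representatives.\<close>

locale hermitian_form =
  fixes Q :: "'h::complex_inner \<Rightarrow> 'h \<Rightarrow> complex"
  assumes add_left: "Q (u + v) w = Q u w + Q v w"
    and scaleC_left: "Q (a *\<^sub>C u) w = a * Q u w"
    and commute: "Q u v = cnj (Q v u)"
    and pos_def: "u \<noteq> 0 \<Longrightarrow> 0 < Re (Q u u)"
begin

lemma zero_left [simp]: "Q 0 w = 0"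
  using scaleC_left[of 0 0 w] by (simp add: scaleC_zero_left)

lemma zero_right [simp]: "Q w 0 = 0"
  using commute[of w 0] by simp

lemma minus_left: "Q (- u) w = - Q u w"
  using scaleC_left[of "-1" u w] by (simp add: scaleC_minus_one)

lemma diff_left: "Q (u - v) w = Q u w - Q v w"
  using add_left[of u "- v" w] by (simp add: minus_left)

lemma add_right: "Q w (u + v) = Q w u + Q w v"
  by (metis add_left commute complex_cnj_add)

lemma scaleC_right: "Q w (a *\<^sub>C u) = cnj a * Q w u"
  by (metis scaleC_left commute complex_cnj_mult)

lemma diff_right: "Q w (u - v) = Q w u - Q w v"
  by (metis diff_left commute complex_cnj_diff)

lemma sum_left: "Q (\<Sum>i\<in>A. f i) w = (\<Sum>i\<in>A. Q (f i) w)"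
  by (induction A rule: infinite_finite_induct) (auto simp: add_left)

lemma sum_right: "Q w (\<Sum>i\<in>A. f i) = (\<Sum>i\<in>A. Q w (f i))"
  by (induction A rule: infinite_finite_induct) (auto simp: add_right)

lemma self_real: "Q u u = complex_of_real (Re (Q u u))"
  using arg_cong[OF commute[of u u], of Im] by (simp add: complex_eq_iff)

definition ortho :: "'h set \<Rightarrow> bool" where
  "ortho U \<longleftrightarrow> (\<forall>u\<in>U. \<forall>v\<in>U. Q u v = (if u = v then 1 else 0))"

text \<open>For a finite orthonormal \<open>U\<close> this is the orthogonal projection onto the
  span of \<open>U\<close>. Accordingly, \<open>proj U s = s\<close> is the way to say that
  \<open>s\<close> lies in that span.\<close>

definition proj :: "'h set \<Rightarrow> 'h \<Rightarrow> 'h" where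
  "proj U v = (\<Sum>u\<in>U. Q v u *\<^sub>C u)"

lemma proj_right:
  assumes "finite U" "ortho U" "u \<in> U"
  shows "Q (proj U v) u = Q v u"
proof -
  have "Q (proj U v) u = (\<Sum>w\<in>U. Q v w * Q w u)"
    by (simp add: proj_def sum_left scaleC_left)
  also have "\<dots> = (\<Sum>w\<in>U. if w = u then Q v w else 0)"
    using assms by (intro sum.cong) (auto simp: ortho_def)
  also have "\<dots> = Q v u"
    using assms by simp
  finally show ?thesis .
qed

lemma proj_residual:
  assumes "finite U" "ortho U" "u \<in> U"
  shows "Q (v - proj U v) u = 0"
  using proj_right[OF assms] by (simp add: diff_left)

lemma orth_proj: "(\<And>u. u \<in> U \<Longrightarrow> Q r u = 0) \<Longrightarrow> Q r (proj U s) = 0"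
  unfolding proj_def sum_right scaleC_right by simp

lemma orth_fixed: "proj U s = s \<Longrightarrow> (\<And>u. u \<in> U \<Longrightarrow> Q r u = 0) \<Longrightarrow> Q r s = 0"
  by (metis orth_proj)

lemma proj_in_csubspace: "csubspace V \<Longrightarrow> U \<subseteq> V \<Longrightarrow> proj U v \<in> V"
  unfolding proj_def by (intro csubspace_sum) (auto intro: csubspace_scaleC)

text \<open>A vector already in the span adds nothing to \<open>U\<close>, whence only an upper
  bound for \<open>card U\<close>. Keeping \<open>U\<close> inside \<open>V\<close> matters later,
  where Riesz representation is available on \<open>V\<close> only.\<close>

lemma gram_schmidt:
  assumes "finite S" "csubspace V" "S \<subseteq> V"
  shows "\<exists>U\<subseteq>V. finite U \<and> card U \<le> card S \<and> ortho U \<and> (\<forall>s\<in>S. proj U s = s)"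
  using assms(1,3)
proof (induction S)
  case empty
  show ?case by (rule exI[of _ "{}"]) (auto simp: ortho_def)
next
  case (insert s S)
  then obtain U where U: "U \<subseteq> V" "finite U" "card U \<le> card S" "ortho U" "\<forall>s\<in>S. proj U s = s"
    by auto
  define r where "r = s - proj U s"
  have rU: "Q r u = 0" if "u \<in> U" for u
    unfolding r_def using proj_residual[OF U(2,4) that] .
  have rV: "r \<in> V"
    unfolding r_def using insert.prems assms(2) U(1) by (auto intro!: csubspace_diff proj_in_csubspace)
  show ?case
  proof (cases "r = 0")
    case True
    then show ?thesis using U insert.hyps by (intro exI[of _ U]) (auto simp: r_def)
  next
    case False
    define c where "c = 1 / sqrt (Re (Q r r))"
    define u where "u = complex_of_real c *\<^sub>C r"
    have pos: "Re (Q r r) > 0" using pos_def[OF False] .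
    then have c2: "c * c * Re (Q r r) = 1"
      by (simp add: c_def)
    have cc: "complex_of_real c * complex_of_real c * Q r r = 1"
      by (subst self_real) (metis c2 of_real_1 of_real_mult)
    have uu: "Q u u = 1"
      unfolding u_def scaleC_left scaleC_right using cc by (simp add: mult.assoc)
    have uw: "Q u w = 0" if "w \<in> U" for w
      using rU[OF that] by (simp add: u_def scaleC_left)
    have wu: "Q w u = 0" if "w \<in> U" for w
      using uw[OF that] commute[of w u] by simp
    have uU: "u \<notin> U" using uu uw by force
    have proj_ins: "proj (insert u U) t = Q t u *\<^sub>C u + proj U t" for t
      using uU U(2) by (simp add: proj_def)
    have "proj (insert u U) t = t" if "t \<in> S" for t
    proof -
      have tt: "proj U t = t" using U(5) that by auto
      have "Q t u = 0"
        using orth_fixed[OF tt, of u] uw commute[of t u] by simp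
      then show ?thesis using tt by (simp add: proj_ins scaleC_zero_left)
    qed
    moreover have "proj (insert u U) s = s"
    proof -
      \<comment> \<open>Since \<open>u\<close> is orthogonal to \<open>proj U s\<close>, the
        coefficient of \<open>s\<close> along \<open>u\<close> is that of \<open>r\<close>, and the
        new term of the projection restores exactly the residual \<open>r\<close>.\<close>
      have "Q (proj U s) u = 0"
        unfolding proj_def sum_left scaleC_left using wu by simp
      then have "Q s u = Q r u"
        unfolding r_def by (simp add: diff_left)
      also have "\<dots> = complex_of_real c * Q r r"
        by (simp add: u_def scaleC_right)
      finally have "Q s u *\<^sub>C u = (complex_of_real c * complex_of_real c * Q r r) *\<^sub>C r"
        by (simp add: u_def scaleC_scaleC mult_ac)
      then have "Q s u *\<^sub>C u = r" by (simp add: cc scaleC_one)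
      then show ?thesis by (simp add: proj_ins r_def)
    qed
    moreover have "ortho (insert u U)"
      using U(4) uu uw wu uU by (auto simp: ortho_def)
    moreover have "u \<in> V" using rV assms(2) by (simp add: u_def csubspace_scaleC)
    ultimately show ?thesis
      using U uU insert.hyps by (intro exI[of _ "insert u U"]) auto
  qed
qed

text \<open>On the span \<open>V\<close> of an orthonormal \<open>U\<close>, a functional is
  determined by its values on \<open>U\<close>, and their conjugates are the coordinates of its
  representative. One \<open>V\<close> serves all functionals \<open>\<phi> j\<close>.\<close>

lemma riesz:
  assumes "finite S"
    and add: "\<And>j u v. \<phi> j (u + v) = \<phi> j u + \<phi> j v"
    and scale: "\<And>j a u. \<phi> j (a *\<^sub>C u) = a * \<phi> j u"
  shows "\<exists>V w. csubspace V \<and> S \<subseteq> V \<and> (\<forall>j. w j \<in> V) \<and> (\<forall>j. \<forall>v\<in>V. \<phi> j v = Q v (w j))"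
proof -
  have "csubspace (UNIV :: 'h set)" by (simp add: csubspace_def)
  from gram_schmidt[OF assms(1) this] obtain U where
    U: "finite U" "ortho U" "\<forall>s\<in>S. proj U s = s" by auto
  define V where "V = {v. proj U v = v}"
  define w where "w j = (\<Sum>u\<in>U. cnj (\<phi> j u) *\<^sub>C u)" for j
  have zero: "\<phi> j 0 = 0" for j using scale[of j 0 0] by (simp add: scaleC_zero_left)
  have phi_sum: "\<phi> j (\<Sum>i\<in>A. f i) = (\<Sum>i\<in>A. \<phi> j (f i))" for j A and f :: "'h \<Rightarrow> 'h"
    by (induction A rule: infinite_finite_induct) (auto simp: add zero)
  have "csubspace V"
    unfolding csubspace_def V_def proj_def
    by (auto simp: add_left scaleC_left scaleC_add_left sum.distrib scaleC_zero_left)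
      (simp flip: scaleC_scaleC scaleC_sum)
  moreover have UV: "U \<subseteq> V"
  proof
    fix v assume v: "v \<in> U"
    have "proj U v = (\<Sum>u\<in>U. if u = v then v else 0)"
      unfolding proj_def using U v
      by (intro sum.cong) (auto simp: ortho_def scaleC_one scaleC_zero_left)
    also have "\<dots> = v" using U v by simp
    finally show "v \<in> V" by (simp add: V_def)
  qed
  moreover have "w j \<in> V" for j
    unfolding w_def by (intro csubspace_sum csubspace_scaleC \<open>csubspace V\<close>) (use UV in auto)
  moreover have "\<phi> j v = Q v (w j)" if "v \<in> V" for j v
  proof -
    have "\<phi> j v = \<phi> j (proj U v)" using that by (simp add: V_def)
    also have "\<dots> = (\<Sum>u\<in>U. Q v u * \<phi> j u)"
      unfolding proj_def phi_sum scale ..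
    also have "\<dots> = Q v (w j)"
      unfolding w_def sum_right scaleC_right by (simp add: mult.commute)
    finally show ?thesis .
  qed
  ultimately show ?thesis using U(3) by (intro exI[of _ V] exI[of _ w]) (auto simp: V_def)
qed

lemma pythagoras:
  assumes "finite U" "ortho U"
  shows "Re (Q (v - proj U v) (v - proj U v)) = Re (Q v v) - (\<Sum>u\<in>U. (cmod (Q v u))\<^sup>2)"
proof -
  have "Q (v - proj U v) (proj U v) = 0"
    using assms by (intro orth_proj proj_residual)
  then have "Q (v - proj U v) (v - proj U v) = Q v v - Q (proj U v) v"
    by (simp add: diff_right diff_left)
  also have "Q (proj U v) v = (\<Sum>u\<in>U. Q v u * cnj (Q v u))"
    unfolding proj_def sum_left scaleC_left by (intro sum.cong refl) (metis commute)
  finally show ?thesis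
    by (simp flip: complex_norm_square)
qed

text \<open>Subtracting a vector \<open>w\<close> of the span does not change the residual, so
  Pythagoras for \<open>v - w\<close> bounds the squared residual of \<open>v\<close>.\<close>

lemma proj_best:
  assumes "finite U" "ortho U" "proj U w = w"
  shows "Re (Q v v) - (\<Sum>u\<in>U. (cmod (Q v u))\<^sup>2) \<le> Re (Q (v - w) (v - w))"
proof -
  let ?d = "v - w"
  have "proj U ?d = proj U v - w"
    using assms(3)
    by (simp add: proj_def diff_left sum_subtractf scaleC_diff_left)
  then have "v - proj U v = ?d - proj U ?d" by (simp add: algebra_simps)
  then have "Re (Q (v - proj U v) (v - proj U v)) = Re (Q (?d - proj U ?d) (?d - proj U ?d))"
    by (rule arg_cong)
  then show ?thesis
    unfolding pythagoras[OF assms(1,2)]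
    using sum_nonneg[of U "\<lambda>u. (cmod (Q ?d u))\<^sup>2"] by simp
qed

end

interpretation cinner: hermitian_form "cinner :: 'h::complex_inner \<Rightarrow> 'h \<Rightarrow> complex"
  by unfold_locales
    (auto simp: cinner_add_left cinner_scaleC_left cinner_self intro: cinner_commute)

section \<open>Frames\<close>

abbreviation frame_coeff :: "('i \<Rightarrow> 'h::complex_inner) \<Rightarrow> 'h \<Rightarrow> 'i \<Rightarrow> real" where
  "frame_coeff e f j \<equiv> (cmod (cinner f (e j)))\<^sup>2"

section \<open>Frame bounds in terms of real sums\<close>

lemma finite_sum_le_ennreal_infsum:
  fixes f :: "'a \<Rightarrow> real"
  assumes "\<And>x. x \<in> A \<Longrightarrow> 0 \<le> f x" "finite F" "F \<subseteq> A"
  shows "ennreal (sum f F) \<le> (\<Sum>\<^sub>\<infinity>x\<in>A. ennreal (f x))"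
proof -
  have "ennreal (sum f F) = (\<Sum>x\<in>F. ennreal (f x))"
    using assms by (intro sum_ennreal[symmetric]) auto
  also have "\<dots> = (\<Sum>\<^sub>\<infinity>x\<in>F. ennreal (f x))"
    using assms by simp
  also have "\<dots> \<le> (\<Sum>\<^sub>\<infinity>x\<in>A. ennreal (f x))"
    using assms by (intro infsum_mono_neutral nonneg_summable_on_complete) auto
  finally show ?thesis .
qed

lemma ennreal_infsum_eq:
  fixes f :: "'a \<Rightarrow> real"
  assumes "f summable_on A" "\<And>x. x \<in> A \<Longrightarrow> 0 \<le> f x"
  shows "(\<Sum>\<^sub>\<infinity>x\<in>A. ennreal (f x)) = ennreal (infsum f A)"
proof (rule antisym)
  show "(\<Sum>\<^sub>\<infinity>x\<in>A. ennreal (f x)) \<le> ennreal (infsum f A)"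
  proof (rule infsum_le_finite_sums)
    fix F assume F: "finite F" "F \<subseteq> A"
    have "(\<Sum>x\<in>F. ennreal (f x)) = ennreal (sum f F)"
      using assms(2) F by (intro sum_ennreal) auto
    also have "\<dots> \<le> ennreal (infsum f A)"
      using assms F by (intro ennreal_leI finite_sum_le_infsum) auto
    finally show "(\<Sum>x\<in>F. ennreal (f x)) \<le> ennreal (infsum f A)" .
  qed (auto intro: nonneg_summable_on_complete)
  show "ennreal (infsum f A) \<le> (\<Sum>\<^sub>\<infinity>x\<in>A. ennreal (f x))"
  proof -
    have "ennreal (infsum f A) = (SUP F\<in>{F. finite F \<and> F \<subseteq> A}. ennreal (sum f F))"
      using assms by (rule infsum_nonneg_is_SUPREMUM_ennreal)
    also have "\<dots> \<le> (\<Sum>\<^sub>\<infinity>x\<in>A. ennreal (f x))"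
      using assms(2) by (intro SUP_least) (auto intro: finite_sum_le_ennreal_infsum)
    finally show ?thesis .
  qed
qed

lemma bessel_finite:
  assumes "upper_frame_bound J e B" "finite F" "F \<subseteq> J"
  shows "(\<Sum>j\<in>F. frame_coeff e f j) \<le> B * (norm f)\<^sup>2"
proof -
  have "ennreal (\<Sum>j\<in>F. frame_coeff e f j) \<le> frame_sum J e f"
    unfolding frame_sum_def by (rule finite_sum_le_ennreal_infsum) (use assms in auto)
  also have "\<dots> \<le> ennreal (B * (norm f)\<^sup>2)"
    using assms(1) by (auto simp: upper_frame_bound_def)
  finally show ?thesis
    using assms(1) by (subst (asm) ennreal_le_iff) (auto simp: upper_frame_bound_def)
qed

lemma frame_coeff_summable:
  assumes "upper_frame_bound J e B"
  shows "frame_coeff e f summable_on J"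
  by (rule nonneg_bdd_above_summable_on) (auto intro!: bdd_aboveI2 bessel_finite[OF assms])

lemma lower_frame_bound_real:
  assumes "lower_frame_bound J e A" "upper_frame_bound J e B"
  shows "A * (norm f)\<^sup>2 \<le> (\<Sum>\<^sub>\<infinity>j\<in>J. frame_coeff e f j)"
proof -
  have "ennreal (A * (norm f)\<^sup>2) \<le> ennreal (\<Sum>\<^sub>\<infinity>j\<in>J. frame_coeff e f j)"
    using assms(1) unfolding lower_frame_bound_def frame_sum_def
    by (subst ennreal_infsum_eq[symmetric, OF frame_coeff_summable[OF assms(2)]]) auto
  then show ?thesis
    by (subst (asm) ennreal_le_iff) (auto intro: infsum_nonneg)
qed

text \<open>The inner product of \<open>T f\<close> with \<open>v\<close>, where \<open>T\<close> is
  the frame operator; the form replaces the operator. Summability, without which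
  \<open>infsum\<close> has the default value 0, will come from the upper frame bound.\<close>

definition frame_form :: "'i set \<Rightarrow> ('i \<Rightarrow> 'h::complex_inner) \<Rightarrow> 'h \<Rightarrow> 'h \<Rightarrow> complex" where
  "frame_form J e f v = (\<Sum>\<^sub>\<infinity>j\<in>J. cinner f (e j) * cnj (cinner v (e j)))"

text \<open>The inequality of arithmetic and geometric means. It gives absolute convergence of the
  frame form and replaces Cauchy-Schwarz in the tail estimate for the dual approximation.\<close>

lemma norm_frame_term_le:
  "cmod (cinner f (e j) * cnj (cinner v (e j))) \<le> 1 / 2 * (frame_coeff e f j + frame_coeff e v j)"
  using sum_squares_bound[of "cmod (cinner f (e j))" "cmod (cinner v (e j))"]
  by (simp add: norm_mult)

lemma frame_term_abs_summable:
  assumes "upper_frame_bound J e B"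
  shows "(\<lambda>j. cmod (cinner f (e j) * cnj (cinner v (e j)))) summable_on J"
proof (rule Infinite_Sum.abs_summable_on_comparison_test')
  show "(\<lambda>j. 1 / 2 * (frame_coeff e f j + frame_coeff e v j)) summable_on J"
    by (intro summable_on_cmult_right summable_on_add frame_coeff_summable[OF assms])
qed (rule norm_frame_term_le)

lemma frame_term_summable:
  assumes "upper_frame_bound J e B"
  shows "(\<lambda>j. cinner f (e j) * cnj (cinner v (e j))) summable_on J"
  using frame_term_abs_summable[OF assms] by (rule Infinite_Sum.abs_summable_summable)

lemma frame_form_self:
  assumes "upper_frame_bound J e B"
  shows "frame_form J e f f = complex_of_real (\<Sum>\<^sub>\<infinity>j\<in>J. frame_coeff e f j)"
  unfolding frame_form_def complex_norm_square[symmetric]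
  using summable_on_of_real[OF frame_coeff_summable[OF assms, of f], where 'a = complex]
    frame_coeff_summable[OF assms, of f]
  by (simp only: infsum_bounded_linear_strong[OF _ bounded_linear_of_real])

text \<open>The upper frame bound provides convergence, the lower one positive definiteness.\<close>

lemma hermitian_frame_form:
  fixes e :: "'i \<Rightarrow> 'h::complex_inner"
  assumes "lower_frame_bound J e A" "upper_frame_bound J e B"
  shows "hermitian_form (frame_form J e)"
proof
  fix u v w :: 'h and a :: complex
  show "frame_form J e (u + v) w = frame_form J e u w + frame_form J e v w"
    unfolding frame_form_def
    by (subst infsum_add[symmetric])
      (auto intro: frame_term_summable[OF assms(2)] simp: cinner_add_left distrib_right)
  show "frame_form J e (a *\<^sub>C u) w = a * frame_form J e u w"
    unfolding frame_form_def
    by (simp add: cinner_scaleC_left mult.assoc infsum_cmult_right')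
  show "frame_form J e u v = cnj (frame_form J e v u)"
    unfolding frame_form_def by (simp flip: infsum_cnj add: mult.commute)
  assume "u \<noteq> 0"
  then have "0 < A * (norm u)\<^sup>2" using assms(1) by (auto simp: lower_frame_bound_def)
  then show "0 < Re (frame_form J e u u)"
    using lower_frame_bound_real[OF assms, of u] by (simp add: frame_form_self[OF assms(2)])
qed

text \<open>
  The span of \<open>U\<close> is that of the Riesz representatives of the functionals
  \<open>\<langle>\<cdot>, e j\<rangle>\<close>, \<open>j \<in> F\<close>, with respect to the frame form (the dual frame elements
  with index in \<open>F\<close>, seen from the span of \<open>S\<close>).
\<close>

lemma finite_dual_approximation:
  fixes e :: "'i \<Rightarrow> 'h::complex_inner"
  assumes low: "lower_frame_bound J e A" and up: "upper_frame_bound J e B"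
    and F: "finite F" "F \<subseteq> J" and S: "finite S"
  shows "\<exists>U. finite U \<and> card U \<le> card F \<and> cinner.ortho U \<and>
    (\<forall>v\<in>S. A * ((norm v)\<^sup>2 - (\<Sum>u\<in>U. (cmod (cinner v u))\<^sup>2))
             \<le> (\<Sum>\<^sub>\<infinity>j\<in>J-F. frame_coeff e v j))"
proof -
  interpret q: hermitian_form "frame_form J e"
    using low up by (rule hermitian_frame_form)
  obtain V w where V: "csubspace V" "S \<subseteq> V" and w: "\<And>j. w j \<in> V"
    and rep: "\<And>j v. v \<in> V \<Longrightarrow> cinner v (e j) = frame_form J e v (w j)"
    using q.riesz[OF S, of "\<lambda>j v. cinner v (e j)"]
    unfolding cinner_add_left cinner_scaleC_left by blast
  \<comment> \<open>The span of \<open>U\<close> contains the representatives \<open>w j\<close>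
    with \<open>j\<close> in \<open>F\<close>, and \<open>U\<close> is orthonormal for the frame
    form.\<close>
  have "\<exists>U\<subseteq>V. finite U \<and> card U \<le> card (w ` F) \<and> q.ortho U \<and> (\<forall>s\<in>w ` F. q.proj U s = s)"
    using F(1) V(1) w by (intro q.gram_schmidt) auto
  then obtain U where U: "U \<subseteq> V" "finite U" "card U \<le> card (w ` F)" "q.ortho U"
    and Uw: "\<And>j. j \<in> F \<Longrightarrow> q.proj U (w j) = w j"
    by blast
  have "csubspace (UNIV :: 'h set)" by (simp add: csubspace_def)
  \<comment> \<open>The conclusion concerns the norm of the Hilbert space, so \<open>U\<close> is
    orthonormalised once more, now for \<open>cinner\<close>.\<close>
  from cinner.gram_schmidt[OF U(2) this] obtain U' where U': "finite U'" "card U' \<le> card U"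
    "cinner.ortho U'" "\<forall>u\<in>U. cinner.proj U' u = u" by auto
  have "A * ((norm v)\<^sup>2 - (\<Sum>u\<in>U'. (cmod (cinner v u))\<^sup>2)) \<le> (\<Sum>\<^sub>\<infinity>j\<in>J-F. frame_coeff e v j)"
    if v: "v \<in> S" for v
  proof -
    define p where "p = q.proj U v"
    define n where "n = v - p"
    have nV: "n \<in> V"
      unfolding n_def p_def using V v U by (auto intro!: csubspace_diff q.proj_in_csubspace)
    have nu: "frame_form J e n u = 0" if "u \<in> U" for u
      unfolding n_def p_def using q.proj_residual[OF U(2,4) that] .
    \<comment> \<open>The error \<open>n\<close> is orthogonal, for the frame form, to the span of
      \<open>U\<close> and hence to \<open>w j\<close>, which represents this coefficient.\<close>
    have nF: "cinner n (e j) = 0" if "j \<in> F" for j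
      using rep[OF nV] q.orth_fixed[OF Uw[OF that] nu] by simp
    have "frame_form J e n p = 0"
      unfolding p_def using nu by (rule q.orth_proj)
    then have nn: "frame_form J e n n = frame_form J e n v"
      unfolding n_def by (simp add: q.diff_right)
    have summ: "frame_coeff e f summable_on J - F" for f
      using frame_coeff_summable[OF up] by (rule summable_on_subset_banach) auto
    have asum: "(\<lambda>j. cmod (cinner n (e j) * cnj (cinner v (e j)))) summable_on J - F"
      using frame_term_abs_summable[OF up] by (rule summable_on_subset_banach) auto
    have nt: "(\<Sum>\<^sub>\<infinity>j\<in>J. frame_coeff e n j) = (\<Sum>\<^sub>\<infinity>j\<in>J-F. frame_coeff e n j)"
      by (rule infsum_cong_neutral) (use nF in auto)
    have "frame_form J e n v = (\<Sum>\<^sub>\<infinity>j\<in>J-F. cinner n (e j) * cnj (cinner v (e j)))"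
      unfolding frame_form_def by (rule infsum_cong_neutral) (use nF in auto)
    moreover have "(\<Sum>\<^sub>\<infinity>j\<in>J. frame_coeff e n j) = cmod (frame_form J e n n)"
      unfolding frame_form_self[OF up] norm_of_real
      by (intro abs_of_nonneg[symmetric] infsum_nonneg) simp
    ultimately have "(\<Sum>\<^sub>\<infinity>j\<in>J. frame_coeff e n j)
        = cmod (\<Sum>\<^sub>\<infinity>j\<in>J-F. cinner n (e j) * cnj (cinner v (e j)))"
      using nn by simp
    also have "\<dots> \<le> (\<Sum>\<^sub>\<infinity>j\<in>J-F. cmod (cinner n (e j) * cnj (cinner v (e j))))"
      using asum by (rule norm_infsum_bound)
    also have "\<dots> \<le> (\<Sum>\<^sub>\<infinity>j\<in>J-F. 1 / 2 * (frame_coeff e n j + frame_coeff e v j))"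
      using asum norm_frame_term_le
      by (intro infsum_mono summable_on_cmult_right summable_on_add summ) auto
    \<comment> \<open>By \<open>nt\<close> the part coming from \<open>n\<close> is half of the
      left-hand side of the chain; absorbing it leaves \<open>le\<close>.\<close>
    also have "\<dots> = 1 / 2 * ((\<Sum>\<^sub>\<infinity>j\<in>J-F. frame_coeff e n j) + (\<Sum>\<^sub>\<infinity>j\<in>J-F. frame_coeff e v j))"
      by (simp only: infsum_cmult_right' infsum_add[OF summ summ])
    finally have le: "(\<Sum>\<^sub>\<infinity>j\<in>J. frame_coeff e n j) \<le> (\<Sum>\<^sub>\<infinity>j\<in>J-F. frame_coeff e v j)"
      using nt by simp
    \<comment> \<open>\<open>p\<close> is a combination of elements of \<open>U\<close>, which lie
      in the span of \<open>U'\<close>. So the residual of \<open>p\<close> is orthogonal to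
      \<open>p\<close> and to its projection, hence to itself.\<close>
    have "cinner.proj U' p = p"
    proof -
      have "cinner n' p = 0" if "\<And>u. u \<in> U' \<Longrightarrow> cinner n' u = 0" for n'
        unfolding p_def q.proj_def cinner.sum_right cinner.scaleC_right
        using cinner.orth_fixed[of U' _ n'] U'(4) that by (intro sum.neutral) auto
      from this[of "p - cinner.proj U' p"] cinner.proj_residual[OF U'(1,3)]
      have "cinner (p - cinner.proj U' p) p = 0" by auto
      moreover have "cinner (p - cinner.proj U' p) (cinner.proj U' p) = 0"
        using U'(1,3) by (intro cinner.orth_proj cinner.proj_residual)
      ultimately have "cinner (p - cinner.proj U' p) (p - cinner.proj U' p) = 0"
        by (simp add: cinner.diff_right)
      then show ?thesis using cinner.pos_def[of "p - cinner.proj U' p"] by force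
    qed
    from cinner.proj_best[OF U'(1,3) this, of v]
    have "(norm v)\<^sup>2 - (\<Sum>u\<in>U'. (cmod (cinner v u))\<^sup>2) \<le> (norm n)\<^sup>2"
      by (simp add: cinner_self n_def)
    then have "A * ((norm v)\<^sup>2 - (\<Sum>u\<in>U'. (cmod (cinner v u))\<^sup>2)) \<le> A * (norm n)\<^sup>2"
      using low by (simp add: lower_frame_bound_def)
    also have "\<dots> \<le> (\<Sum>\<^sub>\<infinity>j\<in>J. frame_coeff e n j)"
      using low up by (rule lower_frame_bound_real)
    finally show ?thesis using le by simp
  qed
  moreover have "card U' \<le> card F"
    using U'(2) U(3) card_image_le[OF F(1), of w] by linarith
  ultimately show ?thesis using U' by (intro exI[of _ U']) auto
qed

text \<open>
  Double counting of the coefficients \<open>\<langle>v k, u\<rangle>\<close>: each \<open>u\<close> receives at most \<open>B\<close>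
  by the upper frame bound, each \<open>v k\<close> gives at least \<open>\<beta>\<close>.
\<close>

lemma frame_card_comparison:
  fixes e :: "'j \<Rightarrow> 'h::complex_inner" and v :: "'i \<Rightarrow> 'h"
  assumes low: "lower_frame_bound J e A" and up: "upper_frame_bound J e C"
    and upv: "upper_frame_bound I v B"
    and F: "finite F" "F \<subseteq> J" and N: "finite N" "N \<subseteq> I"
    and tail: "\<And>k. k \<in> N \<Longrightarrow> (\<Sum>\<^sub>\<infinity>j\<in>J-F. frame_coeff e (v k) j) \<le> A * ((norm (v k))\<^sup>2 - \<beta>)"
  shows "\<beta> * card N \<le> B * card F"
proof -
  obtain U where U: "finite U" "card U \<le> card F" "cinner.ortho U"
    and ap: "\<And>u. u \<in> v ` N \<Longrightarrow> A * ((norm u)\<^sup>2 - (\<Sum>w\<in>U. (cmod (cinner u w))\<^sup>2))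
             \<le> (\<Sum>\<^sub>\<infinity>j\<in>J-F. frame_coeff e u j)"
    using finite_dual_approximation[OF low up F, of "v ` N"] N by blast
  have A: "A > 0" and B: "B > 0" using low upv by (auto simp: lower_frame_bound_def upper_frame_bound_def)
  have "\<beta> \<le> (\<Sum>w\<in>U. (cmod (cinner (v k) w))\<^sup>2)" if k: "k \<in> N" for k
  proof -
    have "A * ((norm (v k))\<^sup>2 - (\<Sum>w\<in>U. (cmod (cinner (v k) w))\<^sup>2)) \<le> A * ((norm (v k))\<^sup>2 - \<beta>)"
      using ap[of "v k"] tail[OF k] k by force
    then show ?thesis using A by simp
  qed
  then have "(\<Sum>k\<in>N. \<beta>) \<le> (\<Sum>k\<in>N. \<Sum>w\<in>U. (cmod (cinner (v k) w))\<^sup>2)"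
    by (rule sum_mono)
  also have "\<dots> = (\<Sum>w\<in>U. \<Sum>k\<in>N. (cmod (cinner (v k) w))\<^sup>2)"
    by (rule sum.swap)
  also have "\<dots> = (\<Sum>w\<in>U. \<Sum>k\<in>N. frame_coeff v w k)"
    by (intro sum.cong refl arg_cong[where f = "\<lambda>r. r\<^sup>2"]) (metis cinner_commute complex_mod_cnj)
  also have "\<dots> \<le> (\<Sum>w\<in>U. B * (norm w)\<^sup>2)"
    by (intro sum_mono bessel_finite[OF upv N])
  also have "\<dots> = (\<Sum>w\<in>U. B)"
  proof (rule sum.cong)
    fix w assume "w \<in> U"
    then have "cinner w w = 1"
      using U(3) by (simp add: cinner.ortho_def)
    then have "(norm w)\<^sup>2 = 1"
      by (metis cinner_self of_real_eq_1_iff)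
    then show "B * (norm w)\<^sup>2 = B" by simp
  qed simp
  also have "\<dots> \<le> B * card F" using U(2) B by simp
  finally show ?thesis by (simp add: mult.commute)
qed

section \<open>Haar measure and tails of square-integrable functions\<close>

lemma translate_eq_vimage: "(+) a ` V = (+) (- a) -` (V :: 'g::group_add set)"
  by (force simp: image_iff add.assoc[symmetric])

lemma open_translate:
  fixes V :: "'g::topological_group_add set"
  assumes "open V"
  shows "open ((+) a ` V)"
  unfolding translate_eq_vimage by (intro open_vimage assms continuous_intros)

lemma uminus_image_eq_vimage: "uminus ` V = uminus -` (V :: 'g::group_add set)"
  by (force simp: image_iff)

lemma open_uminus_image:
  fixes V :: "'g::topological_group_add set"
  assumes "open V"
  shows "open (uminus ` V)"
  unfolding uminus_image_eq_vimage by (intro open_vimage assms continuous_intros)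

lemma compact_sum_set:
  fixes S T :: "'g::topological_group_add set"
  assumes "compact S" "compact T"
  shows "compact {a + b | a b. a \<in> S \<and> b \<in> T}"
proof -
  have "{a + b | a b. a \<in> S \<and> b \<in> T} = (\<lambda>(a, b). a + b) ` (S \<times> T)" by auto
  moreover have "continuous_on (S \<times> T) (\<lambda>(a, b). a + b)"
    unfolding case_prod_unfold by (intro continuous_intros)
  ultimately show ?thesis using assms by (simp add: compact_continuous_image compact_Times)
qed

text \<open>Finitely many translates of \<open>V\<close> cover a given compact set. If
  \<open>V\<close> were null, all compact sets would be null, and by inner regularity the whole
  group too.\<close>

lemma haar_open_pos:
  assumes M: "left_haar_measure M" and V: "open V" "v \<in> V"
  shows "emeasure M V > 0"
proof (rule ccontr)
  assume "\<not> emeasure M V > 0"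
  then have V0: "emeasure M V = 0" by (simp add: zero_less_iff_neq_zero)
  have sets: "sets M = sets borel"
    and UNIV: "emeasure M UNIV = (SUP K\<in>{K. compact K \<and> K \<subseteq> UNIV}. emeasure M K)"
    and ne: "emeasure M UNIV \<noteq> 0"
    using M by (auto simp: left_haar_measure_def)
  have tr: "emeasure M ((+) a ` V) = 0" for a
    using M V V0 by (simp add: left_haar_measure_def)
  have "emeasure M K = 0" if K: "compact K" for K
  proof -
    have "x \<in> (+) (x - v) ` V" for x
      using V(2) by (intro image_eqI[of _ _ v]) auto
    then obtain X where X: "X \<subseteq> K" "finite X" "K \<subseteq> (\<Union>x\<in>X. (+) (x - v) ` V)"
      using compactE_image[OF K, of K "\<lambda>x. (+) (x - v) ` V"] open_translate[OF V(1)]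
      by (metis (no_types, lifting) UN_iff subsetI)
    have "emeasure M K \<le> emeasure M (\<Union>x\<in>X. (+) (x - v) ` V)"
      using X V by (intro emeasure_mono) (auto simp: sets intro!: borel_open open_translate)
    also have "\<dots> \<le> (\<Sum>x\<in>X. emeasure M ((+) (x - v) ` V))"
      using X V by (intro emeasure_subadditive_finite) (auto simp: sets intro!: borel_open open_translate)
    finally show ?thesis using tr by simp
  qed
  then have "emeasure M UNIV \<le> 0" unfolding UNIV by (intro SUP_least) simp
  then show False using ne by simp
qed

text \<open>Each of the finitely many nonzero values is taken on a set of finite measure.\<close>

lemma simple_function_finite_support:
  assumes g: "simple_function M g" and fin: "integral\<^sup>S M g < \<infinity>"
  shows "emeasure M {x\<in>space M. g x \<noteq> 0} < \<infinity>"
proof -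
  let ?Y = "g ` space M - {0}"
  have Y: "finite ?Y" using g by (simp add: simple_function_def)
  have each: "emeasure M (g -` {c} \<inter> space M) < \<infinity>" if "c \<in> ?Y" for c
  proof -
    have "c * emeasure M (g -` {c} \<inter> space M) \<le> integral\<^sup>S M g"
      unfolding simple_integral_def
      using that g by (intro member_le_sum[of c _ "\<lambda>c. c * emeasure M (g -` {c} \<inter> space M)"])
        (auto simp: simple_function_def)
    then have "c * emeasure M (g -` {c} \<inter> space M) < \<infinity>" using fin by (rule le_less_trans)
    then show ?thesis using that by (auto simp: ennreal_mult_less_top)
  qed
  have "{x\<in>space M. g x \<noteq> 0} = (\<Union>c\<in>?Y. g -` {c} \<inter> space M)" by auto
  then have "emeasure M {x\<in>space M. g x \<noteq> 0} \<le> (\<Sum>c\<in>?Y. emeasure M (g -` {c} \<inter> space M))"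
    using Y g by (simp only:) (intro emeasure_subadditive_finite, auto simp: simple_functionD)
  also have "\<dots> < \<infinity>" using Y each by (simp add: ennreal_sum_less_top)
  finally show ?thesis .
qed

text \<open>
  The group need not be \<open>\<sigma>\<close>-compact, so the compact set is found by regularity around
  the support of a simple function approximating \<open>f\<close>.
\<close>

lemma haar_integral_tail:
  fixes M :: "'g::{topological_group_add, t2_space} measure" and f :: "'g \<Rightarrow> ennreal"
  assumes M: "left_haar_measure M" and f: "f \<in> borel_measurable M"
    and fin: "(\<integral>\<^sup>+ x. f x \<partial>M) < \<infinity>" and \<eta>: "\<eta> > (0::real)"
  shows "\<exists>L. compact L \<and> (\<integral>\<^sup>+ x. f x * indicator (- L) x \<partial>M) \<le> ennreal \<eta>"
proof -
  have sets: "sets M = sets borel" using M by (simp add: left_haar_measure_def)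
  then have space: "space M = UNIV" using sets_eq_imp_space_eq by fastforce
  have \<eta>2: "0 < \<eta> / 2" using \<eta> by simp
  let ?G = "{g. simple_function M g \<and> g \<le> f \<and> (\<forall>x. g x < top)}"
  \<comment> \<open>Taking \<open>g\<close> with finite values makes it bounded by a real
    \<open>c\<close> below.\<close>
  have "\<exists>g\<in>?G. (\<integral>\<^sup>+ x. f x \<partial>M) < integral\<^sup>S M g + ennreal (\<eta> / 2)"
  proof (rule SUP_approx_ennreal[OF \<eta>2 _ nn_integral_def_finite])
    have "(\<lambda>_. 0) \<in> ?G" by (auto simp: le_fun_def)
    then show "?G \<noteq> {}" by blast
  qed (use fin in simp)
  then obtain g where g: "simple_function M g" "g \<le> f" "\<And>x. g x < top"
    and app: "(\<integral>\<^sup>+ x. f x \<partial>M) < integral\<^sup>S M g + ennreal (\<eta> / 2)"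
    by auto
  have g_meas: "g \<in> borel_measurable M" using g(1) by (rule borel_measurable_simple_function)
  have gint: "(\<integral>\<^sup>+ x. g x \<partial>M) = integral\<^sup>S M g"
    using g(1) by (rule nn_integral_eq_simple_integral)
  have "(\<integral>\<^sup>+ x. g x \<partial>M) \<le> (\<integral>\<^sup>+ x. f x \<partial>M)"
    using g(2) by (intro nn_integral_mono) (auto simp: le_fun_def)
  then have gfin: "(\<integral>\<^sup>+ x. g x \<partial>M) < \<infinity>" using fin by (rule le_less_trans)
  have diff: "(\<integral>\<^sup>+ x. f x - g x \<partial>M) \<le> ennreal (\<eta> / 2)"
    using nn_integral_diff[OF f g_meas] gfin g(2) app fin
    by (auto simp: le_fun_def gint ennreal_minus_le_iff less_imp_le add.commute)
  obtain c where c: "c \<ge> 0" "\<And>x. g x \<le> ennreal c"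
  proof
    let ?m = "Max (g ` UNIV)"
    have fr: "finite (g ` UNIV)" using g(1) by (simp add: simple_function_def space)
    then have "?m \<in> g ` UNIV" by (intro Max_in) auto
    then have "?m < top" using g(3) by auto
    then show "g x \<le> ennreal (enn2real ?m)" for x using fr by (simp add: less_top)
  qed simp
  \<comment> \<open>On \<open>V - K\<close>, of measure at most \<open>\<delta>\<close>, the bound
    \<open>c\<close> for \<open>g\<close> contributes at most \<open>c * \<delta>\<close>. The
    summand 1 covers the case \<open>c = 0\<close>.\<close>
  define \<delta> where "\<delta> = \<eta> / 2 / (c + 1)"
  have \<delta>: "\<delta> > 0" "c * \<delta> \<le> \<eta> / 2" using \<eta> c(1) by (auto simp: \<delta>_def field_simps)
  define A where "A = {x. g x \<noteq> 0}"
  have "{x \<in> space M. g x \<noteq> 0} \<in> sets M" using g_meas by measurable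
  then have A: "A \<in> sets borel" "emeasure M A < \<infinity>"
    using simple_function_finite_support[OF g(1)] gfin by (simp_all add: A_def gint space sets)
  have "emeasure M A = (INF V\<in>{V. open V \<and> A \<subseteq> V}. emeasure M V)"
    using M A(1) unfolding left_haar_measure_def by blast
  then obtain V where V: "open V" "A \<subseteq> V" "emeasure M V < \<infinity>"
    using A(2) by (auto simp: INF_less_iff)
  have SV: "emeasure M V = (SUP K\<in>{K. compact K \<and> K \<subseteq> V}. emeasure M K)"
    using M V(1) unfolding left_haar_measure_def by blast
  have "\<exists>K\<in>{K. compact K \<and> K \<subseteq> V}. emeasure M V < emeasure M K + ennreal \<delta>"
  proof (rule SUP_approx_ennreal[OF \<delta>(1) _ SV])
    have "{} \<in> {K. compact K \<and> K \<subseteq> V}" by simp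
    then show "{K. compact K \<and> K \<subseteq> V} \<noteq> {}" by blast
  qed (use V(3) in simp)
  then obtain K where K: "compact K" "K \<subseteq> V" "emeasure M V < emeasure M K + ennreal \<delta>"
    by blast
  have KM: "K \<in> sets M" "V \<in> sets M"
    using K V by (auto simp: sets intro: borel_closed borel_open compact_imp_closed)
  have "emeasure M K \<le> emeasure M V" using K KM by (intro emeasure_mono) auto
  then have "emeasure M (V - K) = emeasure M V - emeasure M K"
    using K KM V(3) by (intro emeasure_Diff) auto
  also have "\<dots> \<le> ennreal \<delta>"
    using K(3) V(3) by (auto simp: ennreal_minus_le_iff less_imp_le)
  finally have VK: "emeasure M (V - K) \<le> ennreal \<delta>" .
  have "(\<integral>\<^sup>+ x. f x * indicator (- K) x \<partial>M)
      \<le> (\<integral>\<^sup>+ x. (f x - g x) + ennreal c * indicator (V - K) x \<partial>M)"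
  proof (rule nn_integral_mono)
    fix x
    have "g x \<le> f x" using g(2) by (simp add: le_fun_def)
    then have fg: "f x = (f x - g x) + g x"
      by (simp add: diff_add_cancel_ennreal)
    show "f x * indicator (- K) x \<le> (f x - g x) + ennreal c * indicator (V - K) x"
    proof (cases "x \<in> V - K \<or> x \<in> K")
      case True
      have "f x \<le> (f x - g x) + ennreal c"
        by (metis fg c(2) add_left_mono)
      then show ?thesis using True by (auto simp: indicator_def)
    next
      case False
      then have "g x = 0" using V(2) by (auto simp: A_def)
      then show ?thesis by (simp add: indicator_def)
    qed
  qed
  also have "\<dots> = (\<integral>\<^sup>+ x. f x - g x \<partial>M) + ennreal c * emeasure M (V - K)"
    using f g_meas KM by (subst nn_integral_add) (auto simp: nn_integral_cmult_indicator)
  also have "\<dots> \<le> ennreal (\<eta> / 2) + ennreal c * ennreal \<delta>"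
    using diff VK by (intro add_mono mult_left_mono) auto
  also have "\<dots> \<le> ennreal (\<eta> / 2) + ennreal (\<eta> / 2)"
    using c(1) \<delta> by (intro add_left_mono) (simp add: ennreal_mult'[symmetric] ennreal_leI)
  also have "\<dots> = ennreal \<eta>" using \<eta> by (simp flip: ennreal_plus)
  finally show ?thesis using K(1) by blast
qed

section \<open>Sampling functions of the amalgam space\<close>

lemma local_max_translate_ge:
  fixes U :: "'g::group_add set"
  assumes "t \<in> (+) p ` Q" "uminus ` Q \<subseteq> U"
  shows "ennreal (cmod (F p)) \<le> local_max U F t"
proof -
  obtain q where "q \<in> Q" "t = p + q" using assms(1) by auto
  then have "p \<in> (+) t ` U"
    using assms(2) by (intro image_eqI[of _ _ "- q"]) (auto simp: add.assoc)
  then show ?thesis unfolding local_max_def by (rule SUP_upper)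
qed

lemma amalgam_sampling:
  fixes M :: "'g::{topological_group_add, t2_space} measure" and p :: "'j \<Rightarrow> 'g"
  assumes M: "left_haar_measure M" and meas: "local_max U F \<in> borel_measurable M"
    and Q: "open Q" "uminus ` Q = Q" "Q \<subseteq> U"
    and N: "finite N" "\<And>t. card {j\<in>N. p j \<in> (+) t ` Q} \<le> C"
    and far: "\<And>j. j \<in> N \<Longrightarrow> p j \<notin> {a + u | a u. a \<in> L \<and> u \<in> U}"
    and L: "compact L"
  shows "(\<Sum>j\<in>N. (ennreal (cmod (F (p j))))\<^sup>2) * emeasure M Q
    \<le> of_nat C * (\<integral>\<^sup>+ t. (local_max U F t)\<^sup>2 * indicator (- L) t \<partial>M)"
proof -
  have sets: "sets M = sets borel" using M by (simp add: left_haar_measure_def)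
  have pQ: "(+) a ` Q \<in> sets M" for a
    using Q(1) by (simp add: sets borel_open open_translate)
  have tr: "emeasure M ((+) a ` Q) = emeasure M Q" for a
    using M Q(1) by (simp add: left_haar_measure_def)
  have LM: "- L \<in> sets M" using L by (simp add: sets borel_open open_Compl compact_imp_closed)
  let ?H = "\<lambda>t. (local_max U F t)\<^sup>2 * indicator (- L) t"
  have "(\<Sum>j\<in>N. (ennreal (cmod (F (p j))))\<^sup>2) * emeasure M Q
      = (\<Sum>j\<in>N. \<integral>\<^sup>+ t. (ennreal (cmod (F (p j))))\<^sup>2 * indicator ((+) (p j) ` Q) t \<partial>M)"
    using pQ by (simp add: nn_integral_cmult_indicator tr sum_distrib_right)
  also have "\<dots> = (\<integral>\<^sup>+ t. (\<Sum>j\<in>N. (ennreal (cmod (F (p j))))\<^sup>2 * indicator ((+) (p j) ` Q) t) \<partial>M)"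
    using pQ by (intro nn_integral_sum[symmetric]) auto
  also have "\<dots> \<le> (\<integral>\<^sup>+ t. of_nat C * ?H t \<partial>M)"
  proof (rule nn_integral_mono)
    fix t
    \<comment> \<open>The symmetry of \<open>Q\<close> turns the overlap of cells at
      \<open>t\<close> into the number of samples in a translate of \<open>Q\<close>.\<close>
    have mem: "t \<in> (+) (p j) ` Q \<longleftrightarrow> p j \<in> (+) t ` Q" for j
    proof -
      have "- a + b \<in> Q \<longleftrightarrow> - b + a \<in> Q" for a b
        using Q(2) by (metis add.inverse_inverse image_eqI minus_add)
      then show ?thesis by (simp add: translate_eq_vimage)
    qed
    have "(\<Sum>j\<in>N. (ennreal (cmod (F (p j))))\<^sup>2 * indicator ((+) (p j) ` Q) t)
        \<le> (\<Sum>j\<in>N. if p j \<in> (+) t ` Q then ?H t else 0)"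
    proof (rule sum_mono)
      fix j assume j: "j \<in> N"
      show "(ennreal (cmod (F (p j))))\<^sup>2 * indicator ((+) (p j) ` Q) t
          \<le> (if p j \<in> (+) t ` Q then ?H t else 0)"
      proof (cases "t \<in> (+) (p j) ` Q")
        case True
        obtain q where q: "q \<in> Q" "p j = t + q" using True mem by auto
        \<comment> \<open>Otherwise \<open>p j\<close>, being \<open>t + q\<close> with
          \<open>q\<close> in \<open>U\<close>, would not be far.\<close>
        have "t \<notin> L" using far[OF j] q Q(3) by auto
        then show ?thesis
          using local_max_translate_ge[OF True, of U F] True Q mem
          by (simp add: power_mono)
      next
        case False
        then show ?thesis using mem by simp
      qed
    qed
    also have "\<dots> = of_nat (card {j\<in>N. p j \<in> (+) t ` Q}) * ?H t"
      using N(1) by (simp add: sum.If_cases Int_def)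
    also have "\<dots> \<le> of_nat C * ?H t"
      using N(2)[of t] by (intro mult_right_mono) (auto simp: of_nat_le_iff)
    finally show "(\<Sum>j\<in>N. (ennreal (cmod (F (p j))))\<^sup>2 * indicator ((+) (p j) ` Q) t)
        \<le> of_nat C * ?H t" .
  qed
  also have "\<dots> = of_nat C * (\<integral>\<^sup>+ t. ?H t \<partial>M)"
    using meas LM by (intro nn_integral_cmult) auto
  finally show ?thesis .
qed

section \<open>Unitary representations\<close>

lemma unitary_rep_cinner: "unitary_rep \<pi> \<Longrightarrow> cinner (\<pi> z u) (\<pi> z v) = cinner u v"
  by (simp add: unitary_rep_def unitary_operator_def)

lemma unitary_rep_norm:
  assumes "unitary_rep \<pi>"
  shows "norm (\<pi> z u) = norm u"
proof -
  have "(norm (\<pi> z u))\<^sup>2 = (norm u)\<^sup>2"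
    using unitary_rep_cinner[OF assms, of z u u] unfolding cinner_self of_real_eq_iff .
  then show ?thesis by simp
qed

lemma unitary_rep_zero:
  assumes "unitary_rep \<pi>"
  shows "\<pi> 0 u = u"
proof -
  obtain v where "u = \<pi> 0 v"
    using assms by (meson surjD unitary_operator_def unitary_rep_def)
  moreover have "\<pi> (0 + 0) v = \<pi> 0 (\<pi> 0 v)"
    using assms unfolding unitary_rep_def by (metis comp_apply)
  ultimately show ?thesis by simp
qed

lemma unitary_rep_cinner_shift:
  assumes "unitary_rep \<pi>"
  shows "cinner (\<pi> z u) (\<pi> a v) = cinner u (\<pi> (- z + a) v)"
proof -
  have "\<pi> (z + (- z + a)) v = \<pi> z (\<pi> (- z + a) v)"
    using assms unfolding unitary_rep_def by (metis comp_apply)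
  then show ?thesis
    using unitary_rep_cinner[OF assms, of z u "\<pi> (- z + a) v"] by (simp add: add.assoc[symmetric])
qed

lemma norm_diff_sq_cinner:
  "(norm (u - v))\<^sup>2 = (norm u)\<^sup>2 + (norm v)\<^sup>2 - 2 * Re (cinner u (v :: 'h::complex_inner))"
proof -
  have "cinner (u - v) (u - v) = cinner u u - cinner u v - cnj (cinner u v) + cinner v v"
    by (simp add: cinner.diff_left cinner.diff_right flip: cinner_commute)
  then have "complex_of_real ((norm (u - v))\<^sup>2)
      = complex_of_real ((norm u)\<^sup>2) + complex_of_real ((norm v)\<^sup>2) - (cinner u v + cnj (cinner u v))"
    unfolding cinner_self by simp
  then show ?thesis
    unfolding complex_add_cnj by (simp only: of_real_add[symmetric] of_real_diff[symmetric] of_real_eq_iff)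
qed

text \<open>By strong continuity \<open>\<pi> z g\<close> is close to \<open>g\<close> for
  \<open>z\<close> near 0, so each point \<open>x j\<close> in a translate of \<open>Q\<close> by
  \<open>t\<close> contributes a fixed amount to the frame sum of \<open>\<pi> t g\<close>.\<close>

lemma frame_relatively_separated:
  fixes \<pi> :: "'g::topological_group_add \<Rightarrow> 'h::complex_hilbert \<Rightarrow> 'h"
  assumes \<pi>: "unitary_rep \<pi>" and g: "g \<noteq> 0" and B: "upper_frame_bound J (\<lambda>j. \<pi> (x j) g) B"
  shows "\<exists>Q C. open Q \<and> 0 \<in> Q \<and>
    (\<forall>t N. finite N \<longrightarrow> N \<subseteq> J \<longrightarrow> card {j\<in>N. x j \<in> (+) t ` Q} \<le> C)"
proof -
  define Q where "Q = {z. norm (\<pi> z g - g) < norm g}"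
  \<comment> \<open>The Bessel bound \<open>B * (norm g)\<^sup>2\<close> divided by the least
    contribution \<open>((norm g)\<^sup>2 / 2)\<^sup>2\<close>.\<close>
  define C where "C = nat \<lceil>4 * B / (norm g)\<^sup>2\<rceil>"
  have "open Q"
    unfolding Q_def using \<pi>
    by (intro open_Collect_less continuous_intros) (auto simp: unitary_rep_def)
  moreover have "0 \<in> Q" using g by (simp add: Q_def unitary_rep_zero[OF \<pi>])
  moreover have "card {j\<in>N. x j \<in> (+) t ` Q} \<le> C" if N: "finite N" "N \<subseteq> J" for t N
  proof -
    let ?N = "{j\<in>N. x j \<in> (+) t ` Q}"
    have low: "((norm g)\<^sup>2 / 2)\<^sup>2 \<le> frame_coeff (\<lambda>j. \<pi> (x j) g) (\<pi> t g) j" if "j \<in> ?N" for j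
    proof -
      from that have "norm (\<pi> (- t + x j) g - g) < norm g"
        by (auto simp: Q_def translate_eq_vimage)
      then have "(norm (g - \<pi> (- t + x j) g))\<^sup>2 \<le> (norm g)\<^sup>2"
        by (simp add: norm_minus_commute power_mono)
      then have "(norm g)\<^sup>2 / 2 \<le> Re (cinner g (\<pi> (- t + x j) g))"
        unfolding norm_diff_sq_cinner unitary_rep_norm[OF \<pi>] by simp
      also have "\<dots> \<le> cmod (cinner (\<pi> t g) (\<pi> (x j) g))"
        unfolding unitary_rep_cinner_shift[OF \<pi>] by (rule complex_Re_le_cmod)
      finally show ?thesis by (intro power_mono) auto
    qed
    have "card ?N * ((norm g)\<^sup>2 / 2)\<^sup>2 \<le> (\<Sum>j\<in>?N. frame_coeff (\<lambda>j. \<pi> (x j) g) (\<pi> t g) j)"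
      using low by (intro sum_bounded_below)
    also have "\<dots> \<le> B * (norm (\<pi> t g))\<^sup>2"
      using N by (intro bessel_finite[OF B]) auto
    finally have "card ?N * ((norm g)\<^sup>2 / 2)\<^sup>2 \<le> B * (norm g)\<^sup>2"
      by (simp add: unitary_rep_norm[OF \<pi>])
    then have "card ?N \<le> 4 * B / (norm g)\<^sup>2"
      using g by (simp add: field_simps power2_eq_square)
    then show ?thesis unfolding C_def by linarith
  qed
  ultimately show ?thesis by blast
qed

lemma in_amalgam_integral:
  assumes "in_amalgam M U F"
  shows "(\<integral>\<^sup>+ t. (local_max U F t)\<^sup>2 \<partial>M) < \<infinity>"
  using assms unfolding in_amalgam_def amalgam_norm_def L2_norm_def Let_def
  by (auto simp: less_top split: if_splits)

text \<open>
  The homogeneous approximation property, in the form of tails of the frame coefficients that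
  are small uniformly in the translate.
\<close>

lemma homogeneous_tail:
  fixes M :: "'g::{topological_group_add, t2_space} measure"
    and \<pi> :: "'g \<Rightarrow> 'h::complex_hilbert \<Rightarrow> 'h"
  assumes M: "left_haar_measure M"
    and U: "compact U" "0 \<in> interior U" "uminus ` U = U"
    and \<pi>: "unitary_rep \<pi>" and g: "g \<noteq> 0" "nice_vector M U \<pi> g"
    and B: "upper_frame_bound J (\<lambda>j. \<pi> (x j) g) B" and \<eta>: "\<eta> > 0"
  shows "\<exists>L. compact L \<and> (\<forall>z F. F \<subseteq> J \<longrightarrow> {j\<in>J. - z + x j \<in> L} \<subseteq> F \<longrightarrow>
    (\<Sum>\<^sub>\<infinity>j\<in>J-F. frame_coeff (\<lambda>j. \<pi> (x j) g) (\<pi> z h) j) \<le> \<eta>)"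
proof -
  let ?F = "matrix_coeff \<pi> g h"
  let ?H = "local_max U ?F"
  have am: "in_amalgam M U ?F" using g(2) by (simp add: nice_vector_def)
  then have meas: "?H \<in> borel_measurable M" by (simp add: in_amalgam_def)
  obtain Q0 C where Q0: "open Q0" "0 \<in> Q0"
    and C: "\<And>t N. finite N \<Longrightarrow> N \<subseteq> J \<Longrightarrow> card {j\<in>N. x j \<in> (+) t ` Q0} \<le> C"
    using frame_relatively_separated[OF \<pi> g(1) B] by blast
  define V where "V = Q0 \<inter> interior U"
  \<comment> \<open>Symmetric, for the exchange of cells and samples; inside \<open>U\<close>, for
    the local maximum function; inside \<open>Q0\<close>, for the multiplicity bound.\<close>
  define Q where "Q = V \<inter> uminus ` V"
  have V: "open V" "0 \<in> V" using Q0 U(2) by (auto simp: V_def)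
  have Q: "open Q" "uminus ` Q = Q" "Q \<subseteq> U" "0 \<in> Q" "Q \<subseteq> Q0"
    using V open_uminus_image[OF V(1)] interior_subset[of U]
    by (auto simp: Q_def V_def uminus_image_eq_vimage)
  have sets: "sets M = sets borel" using M by (simp add: left_haar_measure_def)
  have "emeasure M Q \<le> emeasure M U"
    using Q(3) U(1) by (intro emeasure_mono) (auto simp: sets intro: borel_closed compact_imp_closed)
  also have "\<dots> < \<infinity>" using M U(1) by (simp add: left_haar_measure_def)
  finally obtain m where m: "emeasure M Q = ennreal m" "m \<ge> 0"
    by (cases "emeasure M Q") auto
  have m0: "m > 0" using haar_open_pos[OF M Q(1,4)] m by simp
  define \<delta> where "\<delta> = \<eta> * m / (real C + 1)"
  have \<delta>: "\<delta> > 0" "real C * \<delta> \<le> \<eta> * m"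
    using \<eta> m0 by (auto simp: \<delta>_def field_simps)
  obtain L where L: "compact L" "(\<integral>\<^sup>+ t. (?H t)\<^sup>2 * indicator (- L) t \<partial>M) \<le> ennreal \<delta>"
    using haar_integral_tail[OF M _ in_amalgam_integral[OF am] \<delta>(1)] meas by auto
  let ?L = "{a + u | a u. a \<in> L \<and> u \<in> U}"
  have "(\<Sum>\<^sub>\<infinity>j\<in>J-F. frame_coeff (\<lambda>j. \<pi> (x j) g) (\<pi> z h) j) \<le> \<eta>"
    if F: "F \<subseteq> J" "{j\<in>J. - z + x j \<in> ?L} \<subseteq> F" for z F
  proof (rule infsum_le_finite_sums)
    show "frame_coeff (\<lambda>j. \<pi> (x j) g) (\<pi> z h) summable_on J - F"
      using frame_coeff_summable[OF B] by (rule summable_on_subset_banach) auto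
  next
    fix N assume N: "finite N" "N \<subseteq> J - F"
    \<comment> \<open>The coefficients of \<open>\<pi> z h\<close> are samples of one function
      \<open>?F\<close> at translated points. As \<open>L\<close> depends on \<open>?F\<close> only,
      the estimate is uniform in \<open>z\<close>.\<close>
    have coeff: "frame_coeff (\<lambda>j. \<pi> (x j) g) (\<pi> z h) j = (cmod (?F (- z + x j)))\<^sup>2" for j
      by (simp add: matrix_coeff_def unitary_rep_cinner_shift[OF \<pi>])
    have card: "card {j\<in>N. - z + x j \<in> (+) t ` Q} \<le> C" for t
    proof -
      have "{j\<in>N. - z + x j \<in> (+) t ` Q} \<subseteq> {j\<in>N. x j \<in> (+) (z + t) ` Q0}"
      proof clarify
        fix j q assume "j \<in> N" and q: "- z + x j = t + q" "q \<in> Q"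
        have "x j = (z + t) + q" by (metis q(1) add.assoc add_minus_cancel)
        then show "x j \<in> (+) (z + t) ` Q0" using q(2) Q(5) by blast
      qed
      then have "card {j\<in>N. - z + x j \<in> (+) t ` Q} \<le> card {j\<in>N. x j \<in> (+) (z + t) ` Q0}"
        using N(1) by (intro card_mono) auto
      also have "\<dots> \<le> C" using N by (intro C) auto
      finally show ?thesis .
    qed
    have far: "- z + x j \<notin> ?L" if "j \<in> N" for j
      using that N(2) F(2) by blast
    have "ennreal ((\<Sum>j\<in>N. (cmod (?F (- z + x j)))\<^sup>2) * m)
        = (\<Sum>j\<in>N. (ennreal (cmod (?F (- z + x j))))\<^sup>2) * emeasure M Q"
      unfolding m(1) using m(2) by (simp add: ennreal_mult' ennreal_power sum_nonneg flip: sum_ennreal)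
    also have "\<dots> \<le> of_nat C * (\<integral>\<^sup>+ t. (?H t)\<^sup>2 * indicator (- L) t \<partial>M)"
      using amalgam_sampling[OF M meas Q(1-3) N(1) card far L(1)] .
    also have "\<dots> \<le> of_nat C * ennreal \<delta>" using L(2) by (intro mult_left_mono) auto
    also have "\<dots> = ennreal (real C * \<delta>)" by (simp add: ennreal_mult' ennreal_of_nat_eq_real_of_nat)
    also have "\<dots> \<le> ennreal (\<eta> * m)" using \<delta>(2) by (intro ennreal_leI)
    finally have "(\<Sum>j\<in>N. (cmod (?F (- z + x j)))\<^sup>2) * m \<le> \<eta> * m"
      using \<eta> m(2) by (subst (asm) ennreal_le_iff) auto
    then show "(\<Sum>j\<in>N. frame_coeff (\<lambda>j. \<pi> (x j) g) (\<pi> z h) j) \<le> \<eta>"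
      using m0 unfolding coeff by simp
  qed
  then show ?thesis using compact_sum_set[OF L(1) U(1)] by (intro exI[of _ ?L]) blast
qed

section \<open>Counting frame points in translates of compact sets\<close>

theorem theorem4:
  fixes \<mu> :: "'g::{topological_group_add, t2_space} measure"
    and U :: "'g set"
    and \<pi> :: "'g \<Rightarrow> 'h::complex_hilbert \<Rightarrow> 'h"
    and g h :: 'h
    and J :: "'j set" and x :: "'j \<Rightarrow> 'g"
    and I :: "'i set" and y :: "'i \<Rightarrow> 'g"
    and B \<epsilon> :: real
  assumes "locally_compact_space (euclidean :: 'g topology)"
    and "left_haar_measure \<mu>"
    and "compact U" and "0 \<in> interior U" and "uminus ` U = U"
    and "unitary_rep \<pi>"
    and "square_integrable_rep \<mu> \<pi>"
    and "g \<noteq> 0" and "nice_vector \<mu> U \<pi> g"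
    and "is_frame J (\<lambda>j. \<pi> (x j) g)"
    and "is_frame I (\<lambda>k. \<pi> (y k) h)"
    and "B > 0" and "upper_frame_bound I (\<lambda>k. \<pi> (y k) h) B"
    and "\<epsilon> > 0"
  shows "\<exists>L :: 'g set. compact L \<and>
           (\<forall>(z :: 'g) K. compact K \<longrightarrow>
              ereal ((norm h)\<^sup>2 * inverse B * (1 - \<epsilon>)) * ecard {k \<in> I. y k \<in> {z + a | a. a \<in> K}}
                \<le> ecard {j \<in> J. x j \<in> {z + a + l | a l. a \<in> K \<and> l \<in> L}})"
\<comment> \<open>A nonpositive constant, that is \<open>h = 0\<close> or
  \<open>\<epsilon> \<ge> 1\<close>, is trivial with empty \<open>L\<close>.\<close>
proof (cases "(norm h)\<^sup>2 * inverse B * (1 - \<epsilon>) \<le> 0")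
  case True
  have nonneg: "0 \<le> ecard S" for S :: "'s set" by (simp add: ecard_def)
  have "ereal ((norm h)\<^sup>2 * inverse B * (1 - \<epsilon>)) * ecard S \<le> 0" for S :: "'i set"
    using True nonneg[of S] by (simp add: ereal_mult_le_0_iff)
  then show ?thesis using nonneg by (intro exI[of _ "{}"]) (auto intro: order_trans)
next
  case False
  define c where "c = (norm h)\<^sup>2 * inverse B * (1 - \<epsilon>)"
  have c: "c > 0" using False by (simp add: c_def)
  then have h: "(norm h)\<^sup>2 > 0" by (auto simp: c_def)
  obtain A C where A: "lower_frame_bound J (\<lambda>j. \<pi> (x j) g) A"
    and C: "upper_frame_bound J (\<lambda>j. \<pi> (x j) g) C"
    using assms(10) by (auto simp: is_frame_def)
  \<comment> \<open>This tolerance makes every \<open>\<pi> (y k) h\<close> retain at least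
    \<open>(norm h)\<^sup>2 * (1 - \<epsilon>)\<close> in its projection.\<close>
  have "A * \<epsilon> * (norm h)\<^sup>2 > 0" using A h assms(14) by (simp add: lower_frame_bound_def)
  from homogeneous_tail[OF assms(2-6,8,9) C this, of h] obtain L where L: "compact L"
    and tail: "\<And>z F. F \<subseteq> J \<Longrightarrow> {j\<in>J. - z + x j \<in> L} \<subseteq> F \<Longrightarrow>
      (\<Sum>\<^sub>\<infinity>j\<in>J-F. frame_coeff (\<lambda>j. \<pi> (x j) g) (\<pi> z h) j) \<le> A * \<epsilon> * (norm h)\<^sup>2"
    by blast
  have "ereal c * ecard {k \<in> I. y k \<in> {z + a | a. a \<in> K}}
      \<le> ecard {j \<in> J. x j \<in> {z + a + l | a l. a \<in> K \<and> l \<in> L}}" for z K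
  proof -
    define F where "F = {j \<in> J. x j \<in> {z + a + l | a l. a \<in> K \<and> l \<in> L}}"
    define S where "S = {k \<in> I. y k \<in> {z + a | a. a \<in> K}}"
    have bound: "c * card N \<le> card F" if F: "finite F" and N: "finite N" "N \<subseteq> S" for N
    proof -
      have "(norm h)\<^sup>2 * (1 - \<epsilon>) * card N \<le> B * card F"
      proof (rule frame_card_comparison[OF A C assms(13) F _ N(1)])
        fix k assume "k \<in> N"
        then obtain a where a: "a \<in> K" "y k = z + a" using N(2) by (auto simp: S_def)
        \<comment> \<open>One index set \<open>F\<close> serves all \<open>k\<close>, because
          \<open>y k = z + a\<close> with \<open>a\<close> in \<open>K\<close>.\<close>
        have "{j\<in>J. - y k + x j \<in> L} \<subseteq> F"
        proof
          fix j assume j: "j \<in> {j\<in>J. - y k + x j \<in> L}"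
          have "x j = z + a + (- y k + x j)" by (simp add: a(2) add.assoc[symmetric])
          with j a(1) show "j \<in> F" unfolding F_def by blast
        qed
        from tail[OF _ this]
        show "(\<Sum>\<^sub>\<infinity>j\<in>J-F. frame_coeff (\<lambda>j. \<pi> (x j) g) (\<pi> (y k) h) j)
            \<le> A * ((norm (\<pi> (y k) h))\<^sup>2 - (norm h)\<^sup>2 * (1 - \<epsilon>))"
          by (simp add: F_def unitary_rep_norm[OF assms(6)] algebra_simps)
      qed (use N in \<open>auto simp: F_def S_def\<close>)
      then show ?thesis using assms(12) by (simp add: c_def field_simps)
    qed
    have "ereal c * ecard S \<le> ecard F"
    proof (cases "finite F")
      case True
      have "finite S"
      proof (rule ccontr)
        assume "infinite S"
        \<comment> \<open>\<open>Suc\<close> makes \<open>card N\<close> exceed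
          \<open>card F / c\<close> strictly, against \<open>bound\<close>.\<close>
        then obtain N where N: "N \<subseteq> S" "finite N" "card N = Suc (nat \<lceil>card F / c\<rceil>)"
          using infinite_arbitrarily_large by blast
        have "card F / c < card N" unfolding N(3) by linarith
        then show False using bound[OF True N(2,1)] c by (simp add: field_simps)
      qed
      then show ?thesis using bound[OF True _ order_refl] True by (simp add: ecard_def)
    qed (simp add: ecard_def)
    then show ?thesis unfolding F_def S_def .
  qed
  then show ?thesis using L unfolding c_def by blast
qed

end
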